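(* In the status-good game with prestige described in the context, an increase in group $\theta$'s prestige $P_\theta$: (i) strictly decreases consumption for all agents in group $\theta$; (ii) strictly increases consumption for all agents in group $-\theta$; (iii) makes consumption less sensitive to own centrality for all agents in group $\theta$ (that is, $\frac{dx_j^*}{dC_j}=S'_x(Y^*_{\theta_j})$ decreases).
   Context: Agents and network. There are $J$ agents. Agent $j$ has income $w_j\in[1,\infty)$ and identity $\theta_j\in\{A,B\}$; $-\theta$ is the identity other than $\theta$; $I(\theta)=\{k:\theta_k=\theta\}$ is group $\theta$. $G$ is a non-negative $J\times J$ matrix with zero diagonal; $\widehat G_{jk}=G_{jk}\mathbf 1\{\theta_j=\theta_k\}$, $\beta>0$, $H_{jk}=\frac{\beta w_j}{\beta w_j+1}\widehat G_{jk}$. Centrality. $C_j=\sum_k[(I-H)^{-1}]_{jk}\frac{w_k}{\beta w_k+1}$, $\mathcal C_\theta=\frac1{|I(\theta)|}\sum_{k\in I(\theta)}C_k$. Game with prestige. Agents simultaneously choose consumption $x_j\ge0$ with payoff $u_j=S(x_j,Y_{\theta_j})-\frac12\beta(x_j-R_j)^2-\frac1{2w_j}x_j^2$, where $R_j=\sum_k\widehat G_{jk}x_k$, $\mathbf x_\theta=\frac1{|I(\theta)|}\sum_{k\in I(\theta)}x_k$, and group status is $$Y_\theta=\frac{\mathbf x_\theta+P_\theta}{\mathbf x_{-\theta}+P_{-\theta}},$$ with exogenous prestige $P_\theta>0$ for $\theta\in\{A,B\}$. Each agent treats $Y_{\theta_j}$ as fixed when choosing $x_j$. "Consumption" means consumption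 in the Nash equilibrium, $x_j^*=S'_x(Y^*_{\theta_j})\,C_j$, where $Y^*_\theta$ solves $Y_\theta=\frac{S'_x(Y_\theta)\mathcal C_\theta+P_\theta}{S'_x(Y_{-\theta})\mathcal C_{-\theta}+P_{-\theta}}$ with $Y_{-\theta}=1/Y_\theta$. Assumptions (imposed throughout). Utility from own consumption is linear in $x$, so $S'_x=\partial S/\partial x$ is a function of $Y$ only; $S'_x>0$, $S'_Y>0$, $S''_{xY}<0$ for $x\in[0,X]$ and $Y\in[1/Z,Z]$, where $X\ge\psi\rho$, $Z\ge\psi(1+\beta)$, $\psi=\max_jC_j<\infty$, $\rho=S'_x\!\left(\frac1{\psi(1+\beta)}\right)<\infty$. The largest eigenvalue modulus of $G$ is less than $1$.
   Formalization: The formal theorem additionally assumes that the equilibrium statuses before and after the increase in prestige lie in [1/Z, Z], the range where the assumptions on S hold; with prestige this is not implied, and outside that range the claim can fail. *)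

theory Defs
  imports "Jordan_Normal_Form.Spectral_Radius"
begin

datatype identity = Id_A | Id_B

fun other :: "identity \<Rightarrow> identity" where
  "other Id_A = Id_B"
| "other Id_B = Id_A"

text \<open>Agents are the indices \<open>0, \<dots>, J - 1\<close> of the \<open>J \<times> J\<close> matrix \<open>G\<close>; values of agent-indexed
  functions at indices \<open>\<ge> J\<close> are irrelevant.\<close>

definition group_of :: "nat \<Rightarrow> (nat \<Rightarrow> identity) \<Rightarrow> identity \<Rightarrow> nat set" where
  "group_of J ident t = {k. k < J \<and> ident k = t}"

definition group_mean :: "nat \<Rightarrow> (nat \<Rightarrow> identity) \<Rightarrow> (nat \<Rightarrow> real) \<Rightarrow> identity \<Rightarrow> real" where
  "group_mean J ident f t = (\<Sum>k\<in>group_of J ident t. f k) / real (card (group_of J ident t))"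

definition own_group_links :: "nat \<Rightarrow> (nat \<Rightarrow> identity) \<Rightarrow> real mat \<Rightarrow> real mat" where
  "own_group_links J ident G =
     mat J J (\<lambda>(j, k). if ident j = ident k then G $$ (j, k) else 0)"

definition discounted_links ::
  "nat \<Rightarrow> (nat \<Rightarrow> real) \<Rightarrow> (nat \<Rightarrow> identity) \<Rightarrow> real mat \<Rightarrow> real \<Rightarrow> real mat" where
  "discounted_links J w ident G \<beta> =
     mat J J (\<lambda>(j, k). \<beta> * w j / (\<beta> * w j + 1) * own_group_links J ident G $$ (j, k))"

text \<open>\<open>mat_inverse\<close> is option-valued; for an economy satisfying the conditions below the inverse
  exists (see \<open>economy_inverse\<close>).\<close>

definition centrality ::
  "nat \<Rightarrow> (nat \<Rightarrow> real) \<Rightarrow> (nat \<Rightarrow> identity) \<Rightarrow> real mat \<Rightarrow> real \<Rightarrow> nat \<Rightarrow> real" where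
  "centrality J w ident G \<beta> j =
     (\<Sum>k<J. the (mat_inverse (1\<^sub>m J - discounted_links J w ident G \<beta>)) $$ (j, k)
             * (w k / (\<beta> * w k + 1)))"

text \<open>Both groups are required to be nonempty: otherwise group averages, and hence status, are
  undefined.\<close>

definition economy ::
  "nat \<Rightarrow> (nat \<Rightarrow> real) \<Rightarrow> (nat \<Rightarrow> identity) \<Rightarrow> real mat \<Rightarrow> real \<Rightarrow> bool" where
  "economy J w ident G \<beta> \<longleftrightarrow>
     (\<forall>t. group_of J ident t \<noteq> {}) \<and>
     (\<forall>j<J. w j \<ge> 1) \<and> \<beta> > 0 \<and>
     G \<in> carrier_mat J J \<and>
     (\<forall>j<J. \<forall>k<J. G $$ (j, k) \<ge> 0) \<and> (\<forall>j<J. G $$ (j, j) = 0) \<and>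
     spectral_radius (map_mat complex_of_real G) < 1"

text \<open>The function \<open>Sx\<close> is the partial derivative of \<open>S\<close> in own consumption \<open>x\<close>. Linearity of \<open>S\<close> in \<open>x\<close>
  is the fact that \<open>Sx\<close> depends on \<open>Y\<close> only; it is imposed on the whole strategy space \<open>x \<ge> 0\<close>, whereas
  the sign of \<open>S\<close>'s derivative in status is only imposed for \<open>x \<le> X\<close>.\<close>

definition status_utility ::
  "(real \<Rightarrow> real \<Rightarrow> real) \<Rightarrow> (real \<Rightarrow> real) \<Rightarrow> real \<Rightarrow> real \<Rightarrow> bool" where
  "status_utility S Sx X Z \<longleftrightarrow>
     (\<forall>Y\<in>{1/Z..Z}.
        (\<forall>x\<ge>0. ((\<lambda>x. S x Y) has_real_derivative Sx Y) (at x within {0..})) \<and>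
        Sx Y > 0 \<and>
        (\<forall>x\<in>{0..X}. \<exists>D>0. ((\<lambda>Y. S x Y) has_real_derivative D) (at Y within {1/Z..Z})) \<and>
        (\<exists>D<0. (Sx has_real_derivative D) (at Y within {1/Z..Z})))"

definition max_centrality ::
  "nat \<Rightarrow> (nat \<Rightarrow> real) \<Rightarrow> (nat \<Rightarrow> identity) \<Rightarrow> real mat \<Rightarrow> real \<Rightarrow> real" where
  "max_centrality J w ident G \<beta> = Max (centrality J w ident G \<beta> ` {..<J})"

definition reference ::
  "nat \<Rightarrow> (nat \<Rightarrow> identity) \<Rightarrow> real mat \<Rightarrow> (nat \<Rightarrow> real) \<Rightarrow> nat \<Rightarrow> real" where
  "reference J ident G x j = (\<Sum>k<J. own_group_links J ident G $$ (j, k) * x k)"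

definition status ::
  "nat \<Rightarrow> (nat \<Rightarrow> identity) \<Rightarrow> (identity \<Rightarrow> real) \<Rightarrow> (nat \<Rightarrow> real) \<Rightarrow> identity \<Rightarrow> real" where
  "status J ident P x t =
     (group_mean J ident x t + P t) / (group_mean J ident x (other t) + P (other t))"

definition payoff ::
  "nat \<Rightarrow> (nat \<Rightarrow> real) \<Rightarrow> (nat \<Rightarrow> identity) \<Rightarrow> real mat \<Rightarrow> real \<Rightarrow> (real \<Rightarrow> real \<Rightarrow> real)
    \<Rightarrow> real \<Rightarrow> (nat \<Rightarrow> real) \<Rightarrow> nat \<Rightarrow> real" where
  "payoff J w ident G \<beta> S Y x j =
     S (x j) Y - 1/2 * \<beta> * (x j - reference J ident G x j)\<^sup>2 - 1 / (2 * w j) * (x j)\<^sup>2"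

text \<open>A deviating agent takes group status as given: the status argument of \<open>payoff\<close> is the one
  generated by the equilibrium profile \<open>x\<close> on both sides of the inequality.\<close>

definition nash_equilibrium ::
  "nat \<Rightarrow> (nat \<Rightarrow> real) \<Rightarrow> (nat \<Rightarrow> identity) \<Rightarrow> real mat \<Rightarrow> real \<Rightarrow> (real \<Rightarrow> real \<Rightarrow> real)
    \<Rightarrow> (identity \<Rightarrow> real) \<Rightarrow> (nat \<Rightarrow> real) \<Rightarrow> bool" where
  "nash_equilibrium J w ident G \<beta> S P x \<longleftrightarrow>
     (\<forall>j<J. x j \<ge> 0 \<and>
       (\<forall>z\<ge>0. payoff J w ident G \<beta> S (status J ident P x (ident j)) (x(j := z)) j
              \<le> payoff J w ident G \<beta> S (status J ident P x (ident j)) x j))"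

text \<open>Equilibrium consumption as a function of own centrality \<open>c\<close> at equilibrium status \<open>Y\<close>; see
  \<open>nash_equilibrium_iff\<close>.\<close>

definition consumption :: "(real \<Rightarrow> real) \<Rightarrow> real \<Rightarrow> real \<Rightarrow> real" where
  "consumption Sx Y c = Sx Y * c"

lemma other_other [simp]: "other (other t) = t"
  by (cases t) auto

lemma other_neq [simp]: "other t \<noteq> t" "t \<noteq> other t"
  by (cases t; simp)+

lemma spectral_radius_less_1_decay:
  fixes G :: "real mat"
  assumes G: "G \<in> carrier_mat n n" and n: "n > 0"
    and sr: "spectral_radius (map_mat complex_of_real G) < 1"
  obtains r c where "0 < r" "r < 1" "c \<ge> 0"
    "\<And>k i j. i < n \<Longrightarrow> j < n \<Longrightarrow> \<bar>(G ^\<^sub>m k) $$ (i, j)\<bar> \<le> c * r ^ k"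
proof -
  let ?A = "map_mat complex_of_real G"
  have A: "?A \<in> carrier_mat n n" using G by auto
  define r where "r = (1 + spectral_radius ?A) / 2"
  have sr0: "spectral_radius ?A \<ge> 0"
    using spectral_radius_mem_max(1)[OF A n] by auto
  have r: "0 < r" "r < 1" "spectral_radius ?A < r" using sr sr0 by (auto simp: r_def)
  define B where "B = complex_of_real (1 / r) \<cdot>\<^sub>m ?A"
  have B: "B \<in> carrier_mat n n" using A by (auto simp: B_def)
  have AB: "?A = complex_of_real r \<cdot>\<^sub>m B"
    using r by (auto simp: B_def intro!: eq_matI)
  have "spectral_radius B < 1"
  proof -
    obtain \<mu> where mu: "\<mu> \<in> spectrum B" "spectral_radius B = norm \<mu>"
      using spectral_radius_mem_max(1)[OF B n] by auto
    then obtain v where v: "v \<in> carrier_vec n" "v \<noteq> 0\<^sub>v n" "B *\<^sub>v v = \<mu> \<cdot>\<^sub>v v"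
      using B by (auto simp: spectrum_def eigenvalue_def eigenvector_def)
    have "?A *\<^sub>v v = complex_of_real r \<cdot>\<^sub>v (B *\<^sub>v v)"
      unfolding AB using B v(1) by (auto simp: scalar_prod_def sum_distrib_left mult.assoc)
    also have "\<dots> = (complex_of_real r * \<mu>) \<cdot>\<^sub>v v" by (simp add: v smult_smult_assoc)
    finally have "eigenvalue ?A (complex_of_real r * \<mu>)"
      using v A G by (auto simp: eigenvalue_def eigenvector_def)
    then have "norm (complex_of_real r * \<mu>) \<le> spectral_radius ?A"
      by (intro spectral_radius_mem_max(2)[OF A n]) (auto simp: spectrum_def)
    then have "r * norm \<mu> \<le> spectral_radius ?A" using r(1) by (simp add: norm_mult)
    then have "r * norm \<mu> < r * 1" using r(3) by linarith
    then have "norm \<mu> < 1" using r(1) by (subst (asm) mult_less_cancel_left_pos)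
    then show ?thesis using mu by simp
  qed
  from spectral_radius_jnf_norm_bound_less_1_upper_triangular[OF B this]
  obtain c where c: "\<And>k. norm_bound (B ^\<^sub>m k) c" by auto
  have Gk: "G ^\<^sub>m k \<in> carrier_mat n n" for k using G by simp
  have Bk: "B ^\<^sub>m k \<in> carrier_mat n n" for k using B by simp
  have pow: "map_mat complex_of_real (G ^\<^sub>m k) = complex_of_real (r ^ k) \<cdot>\<^sub>m (B ^\<^sub>m k)" for k
  proof (induction k)
    case 0
    show ?case using G B by (auto intro!: eq_matI)
  next
    case (Suc k)
    have "map_mat complex_of_real (G ^\<^sub>m Suc k) = map_mat complex_of_real (G ^\<^sub>m k) * ?A"
      by (simp add: of_real_hom.mat_hom_mult[OF Gk G])
    also have "\<dots> = (complex_of_real (r ^ k) \<cdot>\<^sub>m (B ^\<^sub>m k)) * (complex_of_real r \<cdot>\<^sub>m B)"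
      using Suc AB by simp
    also have "\<dots> = complex_of_real (r ^ Suc k) \<cdot>\<^sub>m (B ^\<^sub>m k * B)"
      using B Bk[of k] by (auto intro!: eq_matI simp: mult.assoc)
    finally show ?case by simp
  qed
  have bd: "\<bar>(G ^\<^sub>m k) $$ (i, j)\<bar> \<le> \<bar>c\<bar> * r ^ k" if ij: "i < n" "j < n" for k i j
  proof -
    have "complex_of_real ((G ^\<^sub>m k) $$ (i, j)) = complex_of_real (r ^ k) * (B ^\<^sub>m k) $$ (i, j)"
      using arg_cong[OF pow[of k], of "\<lambda>M. M $$ (i, j)"] ij
        carrier_matD[OF Gk[of k]] carrier_matD[OF Bk[of k]] by simp
    then have "\<bar>(G ^\<^sub>m k) $$ (i, j)\<bar> = r ^ k * norm ((B ^\<^sub>m k) $$ (i, j))"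
      using r by (metis norm_mult norm_of_real abs_of_nonneg less_imp_le zero_le_power)
    moreover have "norm ((B ^\<^sub>m k) $$ (i, j)) \<le> \<bar>c\<bar>"
      using c[of k] ij carrier_matD[OF Bk[of k]] unfolding norm_bound_def
      by (metis abs_ge_self order_trans)
    ultimately show ?thesis using r by (simp add: mult.commute mult_left_mono)
  qed
  show ?thesis by (rule that[of r "\<bar>c\<bar>"]) (use r bd in auto)
qed

lemma dominated_supersolution_nonneg:
  fixes G :: "real mat" and h :: "nat \<Rightarrow> nat \<Rightarrow> real" and x :: "nat \<Rightarrow> real"
  assumes G: "G \<in> carrier_mat n n"
    and sr: "spectral_radius (map_mat complex_of_real G) < 1"
    and h: "\<And>j k. j < n \<Longrightarrow> k < n \<Longrightarrow> 0 \<le> h j k \<and> h j k \<le> G $$ (j, k)"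
    and super: "\<And>j. j < n \<Longrightarrow> x j \<ge> (\<Sum>k<n. h j k * x k)"
    and i: "i < n"
  shows "x i \<ge> 0"
proof -
  have n: "n > 0" using i by simp
  obtain r c where rc: "0 < r" "r < 1" "c \<ge> 0"
    and bd: "\<And>k i j. i < n \<Longrightarrow> j < n \<Longrightarrow> \<bar>(G ^\<^sub>m k) $$ (i, j)\<bar> \<le> c * r ^ k"
    using spectral_radius_less_1_decay[OF G n sr] by metis
  define m where "m j = max 0 (- x j)" for j
  have m0: "m j \<ge> 0" for j by (simp add: m_def)
  have hm0: "0 \<le> (\<Sum>k<n. h j k * m k)" if "j < n" for j
    using h[OF that] m0 by (intro sum_nonneg mult_nonneg_nonneg) auto
  have mh: "m j \<le> (\<Sum>k<n. h j k * m k)" if j: "j < n" for j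
  proof -
    have "(\<Sum>k<n. h j k * (- x k)) \<le> (\<Sum>k<n. h j k * m k)"
      using h[OF j] by (intro sum_mono mult_left_mono) (auto simp: m_def)
    then have "- x j \<le> (\<Sum>k<n. h j k * m k)"
      using super[OF j] by (simp add: sum_negf)
    then show ?thesis using hm0[OF j] by (simp add: m_def)
  qed
  have Gk: "G ^\<^sub>m k \<in> carrier_mat n n" for k using G by simp
  have pow0: "0 \<le> (G ^\<^sub>m k) $$ (j, l)" if "j < n" "l < n" for j k l
    using that
  proof (induction k arbitrary: l)
    case (Suc k)
    have "(G ^\<^sub>m Suc k) $$ (j, l) = (\<Sum>a<n. (G ^\<^sub>m k) $$ (j, a) * G $$ (a, l))"
      using Suc.prems G Gk[of k] by (simp add: scalar_prod_def atLeast0LessThan)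
    also have "\<dots> \<ge> 0"
      by (intro sum_nonneg mult_nonneg_nonneg Suc.IH) (use h Suc.prems in \<open>auto intro: order_trans\<close>)
    finally show ?case .
  qed (use G in auto)
  have iter: "m j \<le> (\<Sum>l<n. (G ^\<^sub>m k) $$ (j, l) * m l)" if j: "j < n" for j k
  proof (induction k)
    case 0
    have "(\<Sum>l<n. (G ^\<^sub>m 0) $$ (j, l) * m l) = (\<Sum>l<n. if l = j then m l else 0)"
      using G j by (intro sum.cong) auto
    then show ?case using j by simp
  next
    case (Suc k)
    have "(\<Sum>a<n. (G ^\<^sub>m k) $$ (j, a) * m a)
        \<le> (\<Sum>a<n. (G ^\<^sub>m k) $$ (j, a) * (\<Sum>l<n. G $$ (a, l) * m l))"
    proof (intro sum_mono mult_left_mono)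
      fix a assume a: "a \<in> {..<n}"
      have "(\<Sum>l<n. h a l * m l) \<le> (\<Sum>l<n. G $$ (a, l) * m l)"
        using h a m0 by (intro sum_mono mult_right_mono) auto
      then show "m a \<le> (\<Sum>l<n. G $$ (a, l) * m l)" using mh[of a] a by simp
    qed (use pow0 j in auto)
    also have "\<dots> = (\<Sum>l<n. (\<Sum>a<n. (G ^\<^sub>m k) $$ (j, a) * G $$ (a, l)) * m l)"
      unfolding sum_distrib_left sum_distrib_right by (subst sum.swap) (simp add: mult.assoc)
    also have "\<dots> = (\<Sum>l<n. (G ^\<^sub>m Suc k) $$ (j, l) * m l)"
      using j G Gk[of k] by (intro sum.cong) (auto simp: scalar_prod_def atLeast0LessThan)
    finally show ?case using Suc by simp
  qed
  have "m i \<le> (\<Sum>l<n. c * m l) * r ^ k" for k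
  proof -
    have "(\<Sum>l<n. (G ^\<^sub>m k) $$ (i, l) * m l) \<le> (\<Sum>l<n. (c * r ^ k) * m l)"
      using bd[OF i, of _ k] m0 by (intro sum_mono mult_right_mono) (auto intro: order_trans[OF abs_ge_self])
    also have "\<dots> = (\<Sum>l<n. c * m l) * r ^ k"
      unfolding sum_distrib_right by (intro sum.cong) auto
    finally show ?thesis using iter[OF i, of k] by simp
  qed
  moreover have "(\<lambda>k. (\<Sum>l<n. c * m l) * r ^ k) \<longlonglongrightarrow> (\<Sum>l<n. c * m l) * 0"
    using rc by (intro tendsto_intros LIMSEQ_realpow_zero) auto
  ultimately have "m i \<le> 0" by (intro LIMSEQ_le_const) auto
  then show ?thesis by (simp add: m_def)
qed

lemma economy_J_pos: "economy J w ident G \<beta> \<Longrightarrow> J > 0"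
  by (auto simp: economy_def group_of_def)

lemma discounted_links_bounds:
  assumes "economy J w ident G \<beta>" "j < J" "k < J"
  shows "0 \<le> discounted_links J w ident G \<beta> $$ (j, k)"
    and "discounted_links J w ident G \<beta> $$ (j, k) \<le> G $$ (j, k)"
proof -
  have "\<beta> * w j > 0" using assms by (force simp: economy_def)
  then have q: "0 \<le> \<beta> * w j / (\<beta> * w j + 1)" "\<beta> * w j / (\<beta> * w j + 1) \<le> 1" by auto
  have g: "0 \<le> G $$ (j, k)" using assms by (auto simp: economy_def)
  show "0 \<le> discounted_links J w ident G \<beta> $$ (j, k)"
    and "discounted_links J w ident G \<beta> $$ (j, k) \<le> G $$ (j, k)"
    using assms(2,3) g mult_nonneg_nonneg[OF q(1) g] mult_right_mono[OF q(2) g]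
    by (auto simp: discounted_links_def own_group_links_def)
qed

lemma fixed_point_unique:
  assumes e: "economy J w ident G \<beta>"
    and x: "\<And>j. j < J \<Longrightarrow> x j = (\<Sum>k<J. discounted_links J w ident G \<beta> $$ (j, k) * x k) + b j"
    and y: "\<And>j. j < J \<Longrightarrow> y j = (\<Sum>k<J. discounted_links J w ident G \<beta> $$ (j, k) * y k) + b j"
    and j: "j < J"
  shows "x j = y j"
proof -
  let ?h = "\<lambda>j k. discounted_links J w ident G \<beta> $$ (j, k)"
  have G: "G \<in> carrier_mat J J" "spectral_radius (map_mat complex_of_real G) < 1"
    using e by (auto simp: economy_def)
  have nonneg: "0 \<le> u j - v j"
    if u: "\<And>j. j < J \<Longrightarrow> u j = (\<Sum>k<J. ?h j k * u k) + b j"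
      and v: "\<And>j. j < J \<Longrightarrow> v j = (\<Sum>k<J. ?h j k * v k) + b j" for u v
  proof (rule dominated_supersolution_nonneg[OF G, of ?h "\<lambda>j. u j - v j", OF _ _ j], goal_cases)
    case (1 j k) then show ?case using discounted_links_bounds[OF e] by blast
  next
    case (2 j)
    have "(\<Sum>k<J. ?h j k * (u k - v k)) = (\<Sum>k<J. ?h j k * u k) - (\<Sum>k<J. ?h j k * v k)"
      by (simp only: right_diff_distrib sum_subtractf)
    then show ?case using u[OF 2] v[OF 2] by linarith
  qed
  have "0 \<le> x j - y j" "0 \<le> y j - x j" by (rule nonneg; fact)+
  then show ?thesis by simp
qed

lemma economy_inverse:
  assumes e: "economy J w ident G \<beta>"
  obtains M where "mat_inverse (1\<^sub>m J - discounted_links J w ident G \<beta>) = Some M"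
    "M \<in> carrier_mat J J"
    "(1\<^sub>m J - discounted_links J w ident G \<beta>) * M = 1\<^sub>m J"
    "M * (1\<^sub>m J - discounted_links J w ident G \<beta>) = 1\<^sub>m J"
proof -
  let ?H = "discounted_links J w ident G \<beta>"
  let ?A = "1\<^sub>m J - ?H"
  have H: "?H \<in> carrier_mat J J" by (simp add: discounted_links_def)
  then have A: "?A \<in> carrier_mat J J" by auto
  have "det ?A \<noteq> 0"
  proof
    assume "det ?A = 0"
    then obtain v where v: "v \<in> carrier_vec J" "v \<noteq> 0\<^sub>v J" "?A *\<^sub>v v = 0\<^sub>v J"
      using det_0_iff_vec_prod_zero_field[OF A] by auto
    have fp: "v $ j = (\<Sum>k<J. ?H $$ (j, k) * v $ k) + 0" if j: "j < J" for j
    proof -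
      have "0 = (?A *\<^sub>v v) $ j" using v j by simp
      also have "\<dots> = (\<Sum>k<J. ((if j = k then 1 else 0) - ?H $$ (j, k)) * v $ k)"
        using v(1) H j by (simp add: scalar_prod_def atLeast0LessThan)
      also have "\<dots> = (\<Sum>k<J. if k = j then v $ k else 0) - (\<Sum>k<J. ?H $$ (j, k) * v $ k)"
        unfolding sum_subtractf[symmetric] by (intro sum.cong) (auto simp: algebra_simps)
      finally show ?thesis using j by simp
    qed
    have "v $ j = 0" if "j < J" for j
      by (rule fixed_point_unique[OF e, of "\<lambda>j. v $ j" "\<lambda>j. 0" "\<lambda>j. 0", OF fp _ that]) simp_all
    then have "v = 0\<^sub>v J" using v(1) by (intro eq_vecI) auto
    then show False using v(2) by simp
  qed
  then have "?A \<in> Units (ring_mat TYPE(real) J ())" by (rule det_non_zero_imp_unit[OF A])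
  then obtain M where M: "mat_inverse ?A = Some M"
    using mat_inverse(1)[OF A, of "()"] by (cases "mat_inverse ?A") auto
  show ?thesis using that[OF M] mat_inverse(2)[OF A M] by auto
qed

lemma centrality_fixed_point:
  assumes e: "economy J w ident G \<beta>" and j: "j < J"
  shows "centrality J w ident G \<beta> j =
    (\<Sum>k<J. discounted_links J w ident G \<beta> $$ (j, k) * centrality J w ident G \<beta> k)
      + w j / (\<beta> * w j + 1)"
proof -
  let ?H = "discounted_links J w ident G \<beta>" and ?C = "centrality J w ident G \<beta>"
  obtain M where M: "mat_inverse (1\<^sub>m J - ?H) = Some M" "M \<in> carrier_mat J J"
    "(1\<^sub>m J - ?H) * M = 1\<^sub>m J"
    using economy_inverse[OF e] by metis
  have H: "?H \<in> carrier_mat J J" by (simp add: discounted_links_def)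
  define b where "b k = w k / (\<beta> * w k + 1)" for k
  have C: "?C k = (\<Sum>l<J. M $$ (k, l) * b l)" for k
    by (simp add: centrality_def M b_def)
  have "b j = (\<Sum>l<J. if l = j then b l else 0)" using j by simp
  also have "\<dots> = (\<Sum>l<J. ((1\<^sub>m J - ?H) * M) $$ (j, l) * b l)"
    unfolding M(3) using j by (intro sum.cong) auto
  also have "\<dots> = (\<Sum>l<J. (\<Sum>k<J. ((if j = k then 1 else 0) - ?H $$ (j, k)) * M $$ (k, l)) * b l)"
    using j H M(2) by (intro sum.cong) (auto simp: scalar_prod_def atLeast0LessThan intro!: sum.cong)
  also have "\<dots> = (\<Sum>k<J. ((if j = k then 1 else 0) - ?H $$ (j, k)) * ?C k)"
    unfolding C sum_distrib_left sum_distrib_right by (subst sum.swap) (simp add: mult.assoc)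
  also have "\<dots> = (\<Sum>k<J. if k = j then ?C k else 0) - (\<Sum>k<J. ?H $$ (j, k) * ?C k)"
    unfolding sum_subtractf[symmetric] by (intro sum.cong) (auto simp: algebra_simps)
  finally show ?thesis using j by (simp add: b_def)
qed

lemma centrality_pos:
  assumes e: "economy J w ident G \<beta>" and j: "j < J"
  shows "centrality J w ident G \<beta> j > 0"
proof -
  let ?H = "discounted_links J w ident G \<beta>" and ?C = "centrality J w ident G \<beta>"
  have b: "w j / (\<beta> * w j + 1) > 0" if "j < J" for j
  proof -
    have "w j \<ge> 1" "\<beta> > 0" using e that by (auto simp: economy_def)
    then show ?thesis by (simp add: add_pos_pos)
  qed
  have C0: "?C k \<ge> 0" if "k < J" for k
  proof (rule dominated_supersolution_nonneg[of G J "\<lambda>j k. ?H $$ (j, k)", OF _ _ _ _ that], goal_cases)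
    case (3 j k) then show ?case using discounted_links_bounds[OF e] by blast
  next
    case (4 j) then show ?case using centrality_fixed_point[OF e 4] b[OF 4] by linarith
  qed (use e in \<open>simp_all add: economy_def\<close>)
  have "0 \<le> (\<Sum>k<J. ?H $$ (j, k) * ?C k)"
    using discounted_links_bounds[OF e j] C0 by (intro sum_nonneg mult_nonneg_nonneg) auto
  then show ?thesis using centrality_fixed_point[OF e j] b[OF j] by simp
qed

lemma status_utility_linear:
  assumes "status_utility S Sx X Z" "Y \<in> {1/Z..Z}" "x \<ge> 0"
  shows "S x Y = S 0 Y + Sx Y * x"
proof -
  have d: "((\<lambda>x. S x Y - Sx Y * x) has_real_derivative 0) (at z within {0..})" if "z \<ge> 0" for z
    using assms that by (auto simp: status_utility_def intro!: derivative_eq_intros)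
  have d': "((\<lambda>x. S x Y - Sx Y * x) has_real_derivative 0) (at z)" if "z > 0" for z
  proof -
    have "((\<lambda>x. S x Y - Sx Y * x) has_real_derivative 0) (at z within {0<..})"
      by (rule has_field_derivative_subset[OF d]) (use that in auto)
    then show ?thesis using that by (simp add: at_within_open[of z "{0<..}"])
  qed
  have "continuous_on {0..x} (\<lambda>x. S x Y - Sx Y * x)"
    by (rule continuous_on_subset[of "{0..}"])
       (auto intro!: DERIV_continuous_on d)
  then show ?thesis
    using DERIV_isconst_end[of 0 x "\<lambda>x. S x Y - Sx Y * x"] d' assms(3)
    by (cases "x = 0") auto
qed

lemma status_utility_decreasing:
  assumes u: "status_utility S Sx X Z" and ab: "a \<in> {1/Z..Z}" "b \<in> {1/Z..Z}" "a < b"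
  shows "Sx b < Sx a"
proof -
  obtain D where D: "\<And>Y. Y \<in> {1/Z..Z} \<Longrightarrow> D Y < 0 \<and>
      (Sx has_real_derivative D Y) (at Y within {1/Z..Z})"
    using u unfolding status_utility_def by metis
  have "continuous_on {1/Z..Z} Sx" by (rule DERIV_continuous_on) (use D in auto)
  then have "continuous_on {a..b} Sx" by (rule continuous_on_subset) (use ab in auto)
  moreover have "(Sx has_real_derivative D Y) (at Y)" "D Y < 0" if "a < Y" "Y < b" for Y
    using D[of Y] that ab at_within_Icc_at[of "1/Z" Y Z] by auto
  ultimately show ?thesis using DERIV_neg_imp_decreasing_open[OF ab(3), of Sx] by blast
qed

lemma best_reply_iff:
  fixes w \<beta> R s x :: real
  assumes "w > 0" "\<beta> > 0" "R \<ge> 0" "s > 0"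
  shows "(x \<ge> 0 \<and> (\<forall>z\<ge>0. s * z - 1/2 * \<beta> * (z - R)\<^sup>2 - 1 / (2 * w) * z\<^sup>2
            \<le> s * x - 1/2 * \<beta> * (x - R)\<^sup>2 - 1 / (2 * w) * x\<^sup>2))
    \<longleftrightarrow> x = \<beta> * w / (\<beta> * w + 1) * R + s * (w / (\<beta> * w + 1))"
proof -
  define g where "g z = s * z - 1/2 * \<beta> * (z - R)\<^sup>2 - 1 / (2 * w) * z\<^sup>2" for z
  define z0 where "z0 = \<beta> * w / (\<beta> * w + 1) * R + s * (w / (\<beta> * w + 1))"
  have p: "\<beta> * w + 1 > 0" using assms by (simp add: add_pos_pos)
  have z0: "z0 * (\<beta> * w + 1) = w * (\<beta> * R + s)"
  proof -
    have "z0 = (w * (\<beta> * R + s)) / (\<beta> * w + 1)"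
      by (simp add: z0_def add_divide_distrib[symmetric] algebra_simps)
    then show ?thesis using p by simp
  qed
  have z0': "s + \<beta> * R = z0 * (\<beta> + 1 / w)"
    using z0 assms by (simp add: field_simps)
  have z00: "z0 \<ge> 0" using assms p by (simp add: z0_def)
  have "g z = - 1/2 * (\<beta> + 1 / w) * z\<^sup>2 + (s + \<beta> * R) * z - 1/2 * \<beta> * R\<^sup>2" for z
    using assms by (simp add: g_def power2_eq_square field_simps)
  then have g: "g z = - 1/2 * (\<beta> + 1 / w) * z\<^sup>2 + z0 * (\<beta> + 1 / w) * z - 1/2 * \<beta> * R\<^sup>2" for z
    unfolding z0' .
  have key: "g z0 - g z = 1/2 * (\<beta> + 1 / w) * (z - z0)\<^sup>2" for z
  proof -
    have "- 1/2 * q * z0\<^sup>2 + z0 * q * z0 - 1/2 * \<beta> * R\<^sup>2 - (- 1/2 * q * z\<^sup>2 + z0 * q * z - 1/2 * \<beta> * R\<^sup>2)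
        = 1/2 * q * (z - z0)\<^sup>2" for q :: real
      by (simp add: power2_eq_square field_simps)
    from this[of "\<beta> + 1 / w"] show ?thesis unfolding g .
  qed
  have bw: "\<beta> + 1 / w > 0" using assms by (simp add: add_pos_pos)
  have "(x \<ge> 0 \<and> (\<forall>z\<ge>0. g z \<le> g x)) \<longleftrightarrow> x = z0"
  proof
    assume "x \<ge> 0 \<and> (\<forall>z\<ge>0. g z \<le> g x)"
    then have "1/2 * (\<beta> + 1 / w) * (x - z0)\<^sup>2 \<le> 0" using key[of x] z00 by auto
    then have "(x - z0)\<^sup>2 \<le> 0" using bw by (simp add: mult_le_0_iff)
    then show "x = z0" by simp
  next
    assume x: "x = z0"
    have "g z \<le> g z0" for z
    proof -
      have "0 \<le> 1/2 * (\<beta> + 1 / w) * (z - z0)\<^sup>2"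
        using bw by (intro mult_nonneg_nonneg) auto
      then show ?thesis using key[of z] by linarith
    qed
    then show "x \<ge> 0 \<and> (\<forall>z\<ge>0. g z \<le> g x)" using x z00 by auto
  qed
  then show ?thesis by (simp add: g_def z0_def)
qed

lemma reference_upd:
  assumes "economy J w ident G \<beta>" "j < J"
  shows "reference J ident G (x(j := z)) j = reference J ident G x j"
  unfolding reference_def using assms
  by (intro sum.cong) (auto simp: own_group_links_def economy_def)

lemma nash_equilibrium_first_order:
  assumes e: "economy J w ident G \<beta>" and u: "status_utility S Sx X Z"
    and range: "\<And>t. status J ident P x t \<in> {1/Z..Z}"
    and x0: "\<And>j. j < J \<Longrightarrow> x j \<ge> 0"
  shows "nash_equilibrium J w ident G \<beta> S P x \<longleftrightarrow>
    (\<forall>j<J. x j = (\<Sum>k<J. discounted_links J w ident G \<beta> $$ (j, k) * x k)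
                + Sx (status J ident P x (ident j)) * (w j / (\<beta> * w j + 1)))"
proof -
  have "(x j \<ge> 0 \<and>
       (\<forall>z\<ge>0. payoff J w ident G \<beta> S (status J ident P x (ident j)) (x(j := z)) j
              \<le> payoff J w ident G \<beta> S (status J ident P x (ident j)) x j)) \<longleftrightarrow>
       x j = (\<Sum>k<J. discounted_links J w ident G \<beta> $$ (j, k) * x k)
                + Sx (status J ident P x (ident j)) * (w j / (\<beta> * w j + 1))"
    (is "?L \<longleftrightarrow> ?R") if j: "j < J" for j
  proof -
    let ?Y = "status J ident P x (ident j)"
    let ?r = "reference J ident G x j"
    have "w j \<ge> 1" using e j by (auto simp: economy_def)
    then have pos: "w j > 0" "\<beta> > 0" "Sx ?Y > 0"
      using e u range[of "ident j"] by (auto simp: economy_def status_utility_def)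
    have r0: "?r \<ge> 0"
      unfolding reference_def using e j x0
      by (intro sum_nonneg mult_nonneg_nonneg) (auto simp: own_group_links_def economy_def)
    have "?L \<longleftrightarrow> (x j \<ge> 0 \<and> (\<forall>z\<ge>0. Sx ?Y * z - 1/2 * \<beta> * (z - ?r)\<^sup>2 - 1 / (2 * w j) * z\<^sup>2
            \<le> Sx ?Y * x j - 1/2 * \<beta> * (x j - ?r)\<^sup>2 - 1 / (2 * w j) * (x j)\<^sup>2))"
    proof -
      have "payoff J w ident G \<beta> S ?Y (x(j := z)) j =
          S 0 ?Y + (Sx ?Y * z - 1/2 * \<beta> * (z - ?r)\<^sup>2 - 1 / (2 * w j) * z\<^sup>2)" if "z \<ge> 0" for z
        unfolding payoff_def reference_upd[OF e j] fun_upd_same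
        using status_utility_linear[OF u range[of "ident j"] that] by linarith
      moreover have "payoff J w ident G \<beta> S ?Y x j =
          S 0 ?Y + (Sx ?Y * x j - 1/2 * \<beta> * (x j - ?r)\<^sup>2 - 1 / (2 * w j) * (x j)\<^sup>2)"
        unfolding payoff_def
        using status_utility_linear[OF u range[of "ident j"] x0[OF j]] by linarith
      ultimately show ?thesis by simp
    qed
    also have "\<dots> \<longleftrightarrow> x j = \<beta> * w j / (\<beta> * w j + 1) * ?r + Sx ?Y * (w j / (\<beta> * w j + 1))"
      by (rule best_reply_iff) (use pos r0 in auto)
    also have "\<beta> * w j / (\<beta> * w j + 1) * ?r = (\<Sum>k<J. discounted_links J w ident G \<beta> $$ (j, k) * x k)"
      unfolding reference_def sum_distrib_left
      using j by (intro sum.cong) (auto simp: discounted_links_def)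
    finally show ?thesis .
  qed
  then show ?thesis unfolding nash_equilibrium_def by blast
qed

lemma scaled_centrality_fixed_point:
  assumes e: "economy J w ident G \<beta>" and j: "j < J"
  shows "s (ident j) * centrality J w ident G \<beta> j =
    (\<Sum>k<J. discounted_links J w ident G \<beta> $$ (j, k) * (s (ident k) * centrality J w ident G \<beta> k))
      + s (ident j) * (w j / (\<beta> * w j + 1))"
proof -
  have "(\<Sum>k<J. discounted_links J w ident G \<beta> $$ (j, k) * (s (ident k) * centrality J w ident G \<beta> k))
      = s (ident j) * (\<Sum>k<J. discounted_links J w ident G \<beta> $$ (j, k) * centrality J w ident G \<beta> k)"
    unfolding sum_distrib_left using j
    by (intro sum.cong) (auto simp: discounted_links_def own_group_links_def)
  then show ?thesis by (subst centrality_fixed_point[OF e j]) (simp add: algebra_simps)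
qed

lemma nash_equilibrium_iff:
  assumes e: "economy J w ident G \<beta>" and u: "status_utility S Sx X Z"
    and range: "\<And>t. status J ident P x t \<in> {1/Z..Z}"
  shows "nash_equilibrium J w ident G \<beta> S P x \<longleftrightarrow>
    (\<forall>j<J. x j = consumption Sx (status J ident P x (ident j)) (centrality J w ident G \<beta> j))"
    (is "?N \<longleftrightarrow> ?C")
proof
  assume N: ?N
  then have x0: "\<And>j. j < J \<Longrightarrow> x j \<ge> 0" unfolding nash_equilibrium_def by blast
  have fo: "\<forall>j<J. x j = (\<Sum>k<J. discounted_links J w ident G \<beta> $$ (j, k) * x k)
                + Sx (status J ident P x (ident j)) * (w j / (\<beta> * w j + 1))"
    by (rule nash_equilibrium_first_order[OF e u range, THEN iffD1, OF x0 N])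
  show ?C unfolding consumption_def
  proof (intro allI impI)
    fix j assume j: "j < J"
    show "x j = Sx (status J ident P x (ident j)) * centrality J w ident G \<beta> j"
    proof (rule fixed_point_unique[OF e, of x
          "\<lambda>j. Sx (status J ident P x (ident j)) * (w j / (\<beta> * w j + 1))"
          "\<lambda>j. Sx (status J ident P x (ident j)) * centrality J w ident G \<beta> j" j], goal_cases)
      case (1 j) then show ?case by (rule fo[rule_format])
    next
      case (2 j) then show ?case
        by (rule scaled_centrality_fixed_point[OF e, of _ "\<lambda>t. Sx (status J ident P x t)"])
    qed (rule j)
  qed
next
  assume C: ?C
  have s: "Sx (status J ident P x t) > 0" for t
    using u range[of t] by (auto simp: status_utility_def)
  have x0: "x j \<ge> 0" if "j < J" for j
    unfolding C[rule_format, unfolded consumption_def, OF that]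
    by (intro mult_nonneg_nonneg less_imp_le s centrality_pos[OF e that])
  show ?N
  proof (rule nash_equilibrium_first_order[OF e u range, THEN iffD2], goal_cases)
    case (1 j) then show ?case by (rule x0)
  next
    case 2
    show ?case
    proof (intro allI impI)
      fix j assume j: "j < J"
      have "(\<Sum>k<J. discounted_links J w ident G \<beta> $$ (j, k) * x k) =
        (\<Sum>k<J. discounted_links J w ident G \<beta> $$ (j, k) *
          (Sx (status J ident P x (ident k)) * centrality J w ident G \<beta> k))"
        by (intro sum.cong refl arg_cong[where f = "\<lambda>y. _ * y"] C[rule_format, unfolded consumption_def])
           simp
      moreover have "x j = Sx (status J ident P x (ident j)) * centrality J w ident G \<beta> j"
        by (rule C[rule_format, unfolded consumption_def, OF j])
      ultimately show "x j = (\<Sum>k<J. discounted_links J w ident G \<beta> $$ (j, k) * x k)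
                  + Sx (status J ident P x (ident j)) * (w j / (\<beta> * w j + 1))"
        using scaled_centrality_fixed_point[OF e j, of "\<lambda>t. Sx (status J ident P x t)"] by linarith
    qed
  qed
qed

text \<open>The scalar fixed-point equation for equilibrium status.\<close>

lemma nash_equilibrium_status:
  assumes e: "economy J w ident G \<beta>" and u: "status_utility S Sx X Z"
    and range: "\<And>t. status J ident P x t \<in> {1/Z..Z}"
    and N: "nash_equilibrium J w ident G \<beta> S P x"
  shows "status J ident P x t =
    (Sx (status J ident P x t) * group_mean J ident (centrality J w ident G \<beta>) t + P t) /
    (Sx (status J ident P x (other t)) * group_mean J ident (centrality J w ident G \<beta>) (other t)
      + P (other t))"
    and "status J ident P x (other t) = 1 / status J ident P x t"
proof -
  have C: "\<forall>j<J. x j = consumption Sx (status J ident P x (ident j)) (centrality J w ident G \<beta> j)"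
    by (rule nash_equilibrium_iff[OF e u range, THEN iffD1, OF N])
  have m: "group_mean J ident x t =
      Sx (status J ident P x t) * group_mean J ident (centrality J w ident G \<beta>) t" for t
  proof -
    have "(\<Sum>k\<in>group_of J ident t. x k) =
        (\<Sum>k\<in>group_of J ident t. Sx (status J ident P x t) * centrality J w ident G \<beta> k)"
    proof (intro sum.cong refl)
      fix k assume "k \<in> group_of J ident t"
      then have k: "k < J" "ident k = t" by (auto simp: group_of_def)
      show "x k = Sx (status J ident P x t) * centrality J w ident G \<beta> k"
        using C[rule_format, OF k(1)] unfolding k(2) consumption_def .
    qed
    then show ?thesis unfolding group_mean_def sum_distrib_left[symmetric]
      by (simp only: times_divide_eq_right)
  qed
  show "status J ident P x t =
    (Sx (status J ident P x t) * group_mean J ident (centrality J w ident G \<beta>) t + P t) /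
    (Sx (status J ident P x (other t)) * group_mean J ident (centrality J w ident G \<beta>) (other t)
      + P (other t))"
    by (subst (1) status_def) (simp only: m[symmetric])
  show "status J ident P x (other t) = 1 / status J ident P x t"
    by (simp add: status_def)
qed

end

theory Submission
  imports Defs
begin

text \<open>Suppose own status did not rise with own prestige. As marginal utility is decreasing in status
  and the statuses of the two groups are reciprocal, average consumption would weakly rise in the own
  group and weakly fall in the other one; together with the higher prestige this forces own status
  up, a contradiction. So own status rises, and with it marginal utility falls in the own group and
  rises in the other. Equilibrium consumption is marginal utility times a positive centrality.\<close>

text \<open>Positivity of the individual centralities passes to the mean because an economy has no
  empty group: the sum has at least one term and the cardinality is non-zero.\<close>

lemma group_mean_centrality_pos:
  assumes e: "economy J w ident G \<beta>"
  shows "group_mean J ident (centrality J w ident G \<beta>) t > 0"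
proof -
  have "finite (group_of J ident t)" "group_of J ident t \<noteq> {}"
    using e by (auto simp: group_of_def economy_def)
  then show ?thesis
    unfolding group_mean_def
    by (intro divide_pos_pos sum_pos)
       (auto simp: card_gt_0_iff group_of_def intro: centrality_pos[OF e])
qed

text \<open>Membership in \<open>{1/Z..Z}\<close> leaves the sign open, as \<open>Z\<close> may be
  negative here. Positivity comes from the fixed-point equation for status, whose numerator and
  denominator are both positive.\<close>

lemma nash_equilibrium_status_pos:
  assumes e: "economy J w ident G \<beta>" and u: "status_utility S Sx X Z"
    and range: "\<And>t. status J ident P x t \<in> {1/Z..Z}"
    and N: "nash_equilibrium J w ident G \<beta> S P x"
    and P: "\<And>t. P t > 0"
  shows "status J ident P x t > 0"
proof -
  have "Sx (status J ident P x s) * group_mean J ident (centrality J w ident G \<beta>) s + P s > 0" for s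
    using u range[of s] P[of s] group_mean_centrality_pos[OF e, of s]
    by (auto simp: status_utility_def intro!: add_pos_pos mult_pos_pos)
  then show ?thesis
    by (subst nash_equilibrium_status(1)[OF e u range N]) (rule divide_pos_pos)
qed

lemma status_increases_with_prestige:
  assumes e: "economy J w ident G \<beta>" and u: "status_utility S Sx X Z"
    and range: "\<And>t. status J ident P x t \<in> {1/Z..Z}"
    and range': "\<And>t. status J ident P' x' t \<in> {1/Z..Z}"
    and N: "nash_equilibrium J w ident G \<beta> S P x"
    and N': "nash_equilibrium J w ident G \<beta> S P' x'"
    and P: "\<And>t. P t > 0"
    and incr: "P' \<theta> > P \<theta>" "P' (other \<theta>) = P (other \<theta>)"
  shows "status J ident P x \<theta> < status J ident P' x' \<theta>"
    and "status J ident P' x' (other \<theta>) < status J ident P x (other \<theta>)"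
proof -
  define Y where "Y = status J ident P x"
  define Y' where "Y' = status J ident P' x'"
  define C where "C = group_mean J ident (centrality J w ident G \<beta>)"
  \<comment> \<open>Only the entry at \<theta> changes, and it rises from a positive value.\<close>
  have P': "P' t > 0" for t
    using P[of t] P[of \<theta>] incr by (cases t; cases \<theta>) auto
  have C: "C t > 0" for t
    unfolding C_def by (rule group_mean_centrality_pos[OF e])
  have Ypos: "Y t > 0" "Y' t > 0" for t
    unfolding Y_def Y'_def
    by (rule nash_equilibrium_status_pos[OF e u range N P]
          nash_equilibrium_status_pos[OF e u range' N' P'])+
  have Sx: "Sx (Y t) > 0" "Sx (Y' t) > 0" for t
    using u range[of t] range'[of t] by (auto simp: status_utility_def Y_def Y'_def)
  have rec: "Y (other \<theta>) = 1 / Y \<theta>" "Y' (other \<theta>) = 1 / Y' \<theta>"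
    unfolding Y_def Y'_def
    by (rule nash_equilibrium_status(2)[OF e u range N] nash_equilibrium_status(2)[OF e u range' N'])+
  \<comment> \<open>Weak form, because the case refuted below includes equal statuses.\<close>
  have antimono: "Sx b \<le> Sx a" if "a \<in> {1/Z..Z}" "b \<in> {1/Z..Z}" "a \<le> b" for a b
    using status_utility_decreasing[OF u that(1,2)] that(3) by (cases "a = b") auto
  show less: "status J ident P x \<theta> < status J ident P' x' \<theta>"
  proof (rule ccontr)
    assume "\<not> ?thesis"
    then have le: "Y' \<theta> \<le> Y \<theta>" by (simp add: Y_def Y'_def)
    then have le': "Y (other \<theta>) \<le> Y' (other \<theta>)"
      unfolding rec using Ypos by (intro divide_left_mono) auto
    have "Sx (Y \<theta>) \<le> Sx (Y' \<theta>)"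
      using antimono[OF _ _ le] range range' by (simp add: Y_def Y'_def)
    \<comment> \<open>Strictness comes from the prestige term alone; the consumption term rises only
      weakly.\<close>
    then have num: "Sx (Y \<theta>) * C \<theta> + P \<theta> < Sx (Y' \<theta>) * C \<theta> + P' \<theta>"
      using C[of \<theta>] incr(1) by (intro add_le_less_mono mult_right_mono) auto
    have "Sx (Y' (other \<theta>)) \<le> Sx (Y (other \<theta>))"
      using antimono[OF _ _ le'] range range' by (simp add: Y_def Y'_def)
    then have den: "Sx (Y' (other \<theta>)) * C (other \<theta>) + P' (other \<theta>)
        \<le> Sx (Y (other \<theta>)) * C (other \<theta>) + P (other \<theta>)"
      using C[of "other \<theta>"] incr(2) by (simp add: mult_right_mono)
    have "Y \<theta> = (Sx (Y \<theta>) * C \<theta> + P \<theta>) / (Sx (Y (other \<theta>)) * C (other \<theta>) + P (other \<theta>))"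
      unfolding Y_def C_def by (rule nash_equilibrium_status(1)[OF e u range N])
    also have "\<dots> < (Sx (Y' \<theta>) * C \<theta> + P' \<theta>) / (Sx (Y' (other \<theta>)) * C (other \<theta>) + P' (other \<theta>))"
      using num den Sx C P P' by (intro frac_less) (auto intro!: add_pos_pos add_nonneg_nonneg simp: less_imp_le)
    also have "\<dots> = Y' \<theta>"
      unfolding Y'_def C_def by (rule nash_equilibrium_status(1)[OF e u range' N', symmetric])
    finally show False using le by simp
  qed
  show "status J ident P' x' (other \<theta>) < status J ident P x (other \<theta>)"
    using less rec Ypos[of \<theta>] by (simp add: Y_def Y'_def divide_strict_left_mono)
qed

text \<open>The increase in prestige is expressed as a comparison of two equilibria, under profiles
  \<open>P\<close> and \<open>P'\<close> that differ only at \<theta>. Sensitivity to centrality is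
  the derivative in own centrality with equilibrium status held fixed.\<close>

theorem proposition5:
  fixes J :: nat and w :: "nat \<Rightarrow> real" and ident :: "nat \<Rightarrow> identity"
    and G :: "real mat" and \<beta> :: real
    and S :: "real \<Rightarrow> real \<Rightarrow> real" and Sx :: "real \<Rightarrow> real"
    and X Z \<psi> \<rho> :: real
    and P P' :: "identity \<Rightarrow> real" and \<theta> :: identity
    and x x' :: "nat \<Rightarrow> real"
  assumes economy: "economy J w ident G \<beta>"
    and utility: "status_utility S Sx X Z"
    and psi: "\<psi> = max_centrality J w ident G \<beta>"
    and rho: "\<rho> = Sx (1 / (\<psi> * (1 + \<beta>)))"
    and X: "X \<ge> \<psi> * \<rho>"
    and Z: "Z \<ge> \<psi> * (1 + \<beta>)"
    and prestige_pos: "\<And>t. P t > 0"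
    and prestige_increase: "P' \<theta> > P \<theta>" "P' (other \<theta>) = P (other \<theta>)"
    and equilibrium: "nash_equilibrium J w ident G \<beta> S P x"
    and equilibrium': "nash_equilibrium J w ident G \<beta> S P' x'"
    and status_range: "\<And>t. status J ident P x t \<in> {1/Z..Z}"
    and status_range': "\<And>t. status J ident P' x' t \<in> {1/Z..Z}"
  shows "(\<forall>j\<in>group_of J ident \<theta>. x' j < x j) \<and>
         (\<forall>j\<in>group_of J ident (other \<theta>). x' j > x j) \<and>
         (\<forall>j\<in>group_of J ident \<theta>. \<exists>D D'.
            (consumption Sx (status J ident P x \<theta>) has_real_derivative D)
              (at (centrality J w ident G \<beta> j)) \<and>
            (consumption Sx (status J ident P' x' \<theta>) has_real_derivative D')
              (at (centrality J w ident G \<beta> j)) \<and>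
            D' < D)"
proof -
  let ?Y = "status J ident P x" and ?Y' = "status J ident P' x'"
  let ?C = "centrality J w ident G \<beta>"
  note mono = status_increases_with_prestige[OF economy utility status_range status_range'
      equilibrium equilibrium' prestige_pos prestige_increase]
  have own: "Sx (?Y' \<theta>) < Sx (?Y \<theta>)"
    by (rule status_utility_decreasing[OF utility status_range status_range' mono(1)])
  have oth: "Sx (?Y (other \<theta>)) < Sx (?Y' (other \<theta>))"
    by (rule status_utility_decreasing[OF utility status_range' status_range mono(2)])
  \<comment> \<open>Centralities depend only on network, incomes, identities and \<beta>, so the
    same positive factor \<open>?C j\<close> appears in both equilibria and only marginal utility
    has to be compared.\<close>
  have x: "x j = Sx (?Y t) * ?C j" "x' j = Sx (?Y' t) * ?C j" "?C j > 0"
    if "j \<in> group_of J ident t" for j t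
    using that nash_equilibrium_iff[OF economy utility status_range] equilibrium
      nash_equilibrium_iff[OF economy utility status_range'] equilibrium'
      centrality_pos[OF economy]
    by (auto simp: group_of_def consumption_def)
  \<comment> \<open>At fixed status, consumption is linear in own centrality, so the slope is
    marginal utility itself and \<open>own\<close> orders the two slopes.\<close>
  have deriv: "(consumption Sx y has_real_derivative Sx y) (at c)" for y c
    unfolding consumption_def by (auto intro!: derivative_eq_intros)
  show ?thesis
  proof (intro conjI ballI)
    show "\<exists>D D'. (consumption Sx (?Y \<theta>) has_real_derivative D) (at (?C j)) \<and>
        (consumption Sx (?Y' \<theta>) has_real_derivative D') (at (?C j)) \<and> D' < D" for j
      using deriv own by blast
  qed (use own oth x in \<open>auto intro!: mult_strict_right_mono\<close>)
qed

end
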